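(* Let $k\ge 2$ be fixed. There is an $O(n^{k})$-time algorithm which, given a graph $G$ with $n$ vertices and $\alpha(G)=k$, decides whether $G\in\mathbf{W_2}$.
   Context: Graphs are finite, simple, undirected. A set is independent if its vertices are pairwise nonadjacent; maximum if no independent set is larger. $\alpha(G)$ is the maximum size of an independent set. $G\in\mathbf{W_2}$ if every two disjoint independent sets of $G$ are contained in two disjoint maximum independent sets of $G$. *)

theory Defs
  imports "Graph_Theory.Pair_Digraph" "HOL-Library.Landau_Symbols"
begin

section \<open>Graphs\<close>

text \<open>
  A finite simple undirected graph is a \<^locale>\<open>pair_graph\<close>: a finite vertex set with a finite,
  symmetric, loop-free set of arcs. The vertices \<open>u\<close> and \<open>v\<close> are adjacent iff \<open>(u, v)\<close> is an arc.
\<close>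

definition independent :: "'a pair_pre_digraph \<Rightarrow> 'a set \<Rightarrow> bool" where
  "independent G I \<longleftrightarrow> I \<subseteq> pverts G \<and> (\<forall>u\<in>I. \<forall>v\<in>I. (u, v) \<notin> parcs G)"

definition max_independent :: "'a pair_pre_digraph \<Rightarrow> 'a set \<Rightarrow> bool" where
  "max_independent G I \<longleftrightarrow> independent G I \<and> (\<forall>J. independent G J \<longrightarrow> card J \<le> card I)"

definition independence_number :: "'a pair_pre_digraph \<Rightarrow> nat" where
  "independence_number G = Max (card ` {I. independent G I})"

definition W2 :: "'a pair_pre_digraph \<Rightarrow> bool" where
  "W2 G \<longleftrightarrow>
     (\<forall>A B. independent G A \<and> independent G B \<and> A \<inter> B = {} \<longrightarrow>
        (\<exists>S T. max_independent G S \<and> max_independent G T \<and> S \<inter> T = {} \<and> A \<subseteq> S \<and> B \<subseteq> T))"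


section \<open>Random access machines\<close>

text \<open>
  The model of computation is the unit-cost random access machine with words of logarithmic
  length. A program is a fixed list of instructions. It works on registers, which instructions
  name directly, and on a memory, which is addressed through registers. The only arithmetic is
  addition and truncated subtraction; in particular there is no multiplication.
\<close>

datatype instr =
    Const nat nat     \<comment> \<open>\<open>Const r c\<close>: \<open>R[r] := c\<close>\<close>
  | Add nat nat nat   \<comment> \<open>\<open>Add r s t\<close>: \<open>R[r] := R[s] + R[t]\<close>\<close>
  | Sub nat nat nat   \<comment> \<open>\<open>Sub r s t\<close>: \<open>R[r] := max 0 (R[s] - R[t])\<close>\<close>
  | Load nat nat      \<comment> \<open>\<open>Load r s\<close>: \<open>R[r] := M[R[s]]\<close>\<close>
  | Store nat nat     \<comment> \<open>\<open>Store r s\<close>: \<open>M[R[r]] := R[s]\<close>\<close>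
  | Jump nat          \<comment> \<open>\<open>Jump l\<close>: continue at instruction \<open>l\<close>\<close>
  | JumpZero nat nat  \<comment> \<open>\<open>JumpZero r l\<close>: continue at instruction \<open>l\<close> if \<open>R[r] = 0\<close>\<close>

type_synonym program = "instr list"

text \<open>A configuration \<open>(pc, R, M)\<close>: program counter, register contents, memory contents.\<close>

type_synonym config = "nat \<times> (nat \<Rightarrow> nat) \<times> (nat \<Rightarrow> nat)"

fun exec :: "instr \<Rightarrow> config \<Rightarrow> config" where
  "exec (Const r c) (pc, R, M) = (Suc pc, R(r := c), M)"
| "exec (Add r s t) (pc, R, M) = (Suc pc, R(r := R s + R t), M)"
| "exec (Sub r s t) (pc, R, M) = (Suc pc, R(r := R s - R t), M)"
| "exec (Load r s) (pc, R, M) = (Suc pc, R(r := M (R s)), M)"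
| "exec (Store r s) (pc, R, M) = (Suc pc, R, M(R r := R s))"
| "exec (Jump l) (pc, R, M) = (l, R, M)"
| "exec (JumpZero r l) (pc, R, M) = (if R r = 0 then l else Suc pc, R, M)"

text \<open>A program halts when its program counter points past its last instruction.\<close>

definition halted :: "program \<Rightarrow> config \<Rightarrow> bool" where
  "halted P c \<longleftrightarrow> fst c \<ge> length P"

definition step :: "program \<Rightarrow> config \<Rightarrow> config" where
  "step P c = (if halted P c then c else exec (P ! fst c) c)"

definition run :: "program \<Rightarrow> nat \<Rightarrow> config \<Rightarrow> config" where
  "run P t c = (step P ^^ t) c"

definition words_bounded :: "nat \<Rightarrow> config \<Rightarrow> bool" where
  "words_bounded b = (\<lambda>(pc, R, M). (\<forall>i. R i \<le> b) \<and> (\<forall>a. M a \<le> b))"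


section \<open>Deciding graph properties\<close>

text \<open>
  Input is a graph with vertex set \<open>{0, ..., n - 1}\<close>, given by \<open>n\<close> in cell \<open>0\<close> of the memory and by
  its adjacency matrix, stored row by row from cell \<open>1\<close> on. Everything else is initially \<open>0\<close>.
\<close>

definition graph_memory :: "nat \<Rightarrow> nat pair_pre_digraph \<Rightarrow> nat \<Rightarrow> nat" where
  "graph_memory n G a =
     (if a = 0 then n
      else if a \<le> n * n then of_bool (((a - 1) div n, (a - 1) mod n) \<in> parcs G)
      else 0)"

definition initial_config :: "nat \<Rightarrow> nat pair_pre_digraph \<Rightarrow> config" where
  "initial_config n G = (0, (\<lambda>_. 0), graph_memory n G)"

text \<open>
  \<open>P\<close> decides \<open>Q\<close> within time \<open>T\<close> on the graphs satisfying the promise \<open>D\<close>: on every such graph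
  with \<open>n\<close> vertices, \<open>P\<close> halts after at most \<open>T n\<close> steps with the answer (\<open>1\<close> for yes, \<open>0\<close> for no)
  in register \<open>0\<close>. All words that occur during the computation are bounded by a polynomial in \<open>n\<close>,
  i.e. have \<open>O(log n)\<close> bits; otherwise unit cost would be unrealistic. The program
  and the exponent of the polynomial do not depend on the input.
\<close>

definition decides_within ::
  "program \<Rightarrow> (nat \<Rightarrow> real) \<Rightarrow> (nat pair_pre_digraph \<Rightarrow> bool) \<Rightarrow> (nat pair_pre_digraph \<Rightarrow> bool) \<Rightarrow> bool"
where
  "decides_within P T D Q \<longleftrightarrow>
     (\<exists>c. \<forall>n G. pair_graph G \<and> pverts G = {..<n} \<and> D G \<longrightarrow>
        (\<exists>t pc R M. real t \<le> T n \<and>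
           run P t (initial_config n G) = (pc, R, M) \<and>
           halted P (pc, R, M) \<and>
           R 0 = (if Q G then 1 else 0) \<and>
           (\<forall>s\<le>t. words_bounded (n ^ c + c) (run P s (initial_config n G)))))"

end

theory Submission
  imports Defs
begin

text \<open>
  Call a vertex extending for an independent set \<open>A\<close> if it lies outside \<open>A\<close> and has no neighbour
  in \<open>A\<close>. A graph is in W2 iff every independent set with fewer than \<open>k\<close> vertices, where \<open>k\<close> is the
  independence number, has at least two extending vertices. Indeed, if at most one vertex extends
  \<open>A\<close>, then \<open>A\<close> and the set of its extending vertices lie in no two disjoint maximum independent
  sets. Conversely, the condition lets disjoint independent sets grow, one vertex at a time and
  without meeting, until both are maximum. The condition refers to the number of extending vertices
  only, so it is checked in time \<open>O(n)\<close> for each of the \<open>n ^ (k - 1)\<close> lists of \<open>k - 1\<close> vertices.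
\<close>

section \<open>Characterising W2 through extending vertices\<close>

definition extending :: "'a pair_pre_digraph \<Rightarrow> 'a set \<Rightarrow> 'a set" where
  "extending G A = {v \<in> pverts G - A. \<forall>u\<in>A. (u, v) \<notin> parcs G}"

context pair_graph
begin

lemma independent_finite: "independent G A \<Longrightarrow> finite A"
  unfolding independent_def using finite_subset pair_finite_verts by blast

lemma finite_extending [simp]: "finite (extending G A)"
  by (simp add: extending_def)

lemma not_loop: "(v, v) \<notin> parcs G"
  using pair_no_loops[of "(v, v)"] by auto

lemma parcs_sym: "(u, v) \<in> parcs G \<Longrightarrow> (v, u) \<in> parcs G"
  using arcs_symmetric by simp

lemma finite_card_independent: "finite (card ` {I. independent G I})"
proof -
  have "{I. independent G I} \<subseteq> Pow (pverts G)"
    by (auto simp: independent_def)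
  then show ?thesis
    using finite_subset pair_finite_verts by blast
qed

lemma card_le_independence_number: "independent G A \<Longrightarrow> card A \<le> independence_number G"
  unfolding independence_number_def using finite_card_independent by (intro Max_ge) auto

lemma obtain_independence_number:
  obtains I where "independent G I" "card I = independence_number G"
proof -
  have "independent G {}"
    by (simp add: independent_def)
  then have "card ` {I. independent G I} \<noteq> {}"
    by blast
  from Max_in[OF finite_card_independent this] that show ?thesis
    unfolding independence_number_def by auto
qed

lemma max_independent_iff:
  "max_independent G I \<longleftrightarrow> independent G I \<and> card I = independence_number G"
  by (metis card_le_independence_number le_antisym max_independent_def obtain_independence_number)

lemma independence_number_le: "independence_number G \<le> card (pverts G)"
  by (metis card_mono independent_def obtain_independence_number pair_finite_verts)

lemma independent_insert_extending:
  "independent G A \<Longrightarrow> v \<in> extending G A \<Longrightarrow> independent G (insert v A)"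
  unfolding independent_def extending_def using not_loop parcs_sym by auto

lemma extending_if_independent_superset:
  "independent G S \<Longrightarrow> A \<subseteq> S \<Longrightarrow> v \<in> S - A \<Longrightarrow> v \<in> extending G A"
  unfolding independent_def extending_def by auto

text \<open>A set of at most one vertex is independent, as there are no loops, so \<open>W2\<close>
  applies to \<open>A\<close> and its extending set. The larger set \<open>S\<close> adds some
  vertex to \<open>A\<close>; that vertex extends \<open>A\<close>, hence also lies in
  \<open>T\<close>.\<close>

lemma W2_imp_card_extending:
  assumes "W2 G" "independent G A" "card A < independence_number G"
  shows "2 \<le> card (extending G A)"
proof (rule ccontr)
  assume "\<not> 2 \<le> card (extending G A)"
  then have "card (extending G A) \<le> Suc 0"
    by simp
  then have eq: "\<forall>u\<in>extending G A. \<forall>v\<in>extending G A. u = v"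
    by (subst (asm) card_le_Suc0_iff_eq) simp
  then have "independent G (extending G A)"
    unfolding independent_def using not_loop by (auto simp: extending_def)
  moreover have "A \<inter> extending G A = {}"
    by (auto simp: extending_def)
  ultimately obtain S T where ST: "max_independent G S" "S \<inter> T = {}" "A \<subseteq> S" "extending G A \<subseteq> T"
    using assms unfolding W2_def by meson
  have "card S > card A"
    using ST assms max_independent_iff by auto
  then obtain v where "v \<in> S - A"
    using ST by (metis Diff_eq_empty_iff equals0I leD subset_antisym order_refl)
  then have "v \<in> extending G A"
    using extending_if_independent_superset ST max_independent_iff by blast
  with ST \<open>v \<in> S - A\<close> show False
    by blast
qed

text \<open>
  If \<open>B\<close> contained all vertices extending \<open>A\<close>, then \<open>A\<close> together with all of these but one would
  be an independent set with at most one extending vertex.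
\<close>

lemma extending_outside:
  assumes ext: "\<And>A. independent G A \<Longrightarrow> card A < independence_number G \<Longrightarrow> 2 \<le> card (extending G A)"
    and A: "independent G A" "card A < independence_number G" and B: "independent G B"
  shows "\<exists>v\<in>extending G A. v \<notin> B"
proof (rule ccontr)
  assume "\<not> ?thesis"
  then have sub: "extending G A \<subseteq> B"
    by blast
  define C where "C = A \<union> extending G A"
  \<comment> \<open>Edges meeting \<open>A\<close> are excluded by the definition of
    \<open>extending\<close>; edges among the extending vertices are excluded because these all lie
    in the independent set \<open>B\<close>.\<close>
  have C: "independent G C"
    unfolding C_def independent_def
  proof (intro conjI ballI)
    show "A \<union> extending G A \<subseteq> pverts G"
      using A by (auto simp: independent_def extending_def)
    have *: "(u, v) \<notin> parcs G \<and> (v, u) \<notin> parcs G" if "u \<in> A" "v \<in> A \<union> extending G A" for u v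
      using that A(1) parcs_sym unfolding independent_def extending_def by blast
    fix u v assume "u \<in> A \<union> extending G A" "v \<in> A \<union> extending G A"
    then show "(u, v) \<notin> parcs G"
      using * B sub unfolding independent_def by blast
  qed
  have "2 \<le> card (extending G A)"
    using ext A by blast
  then obtain e where e: "e \<in> extending G A"
    by fastforce
  have "independent G (C - {e})"
    using C by (auto simp: independent_def)
  moreover have "card (C - {e}) < independence_number G"
    using C e card_le_independence_number[OF C] independent_finite[OF C] card_Diff1_less[of C e]
    by (auto simp: C_def)
  ultimately have "2 \<le> card (extending G (C - {e}))"
    by (rule ext)
  \<comment> \<open>Since \<open>A\<close> is contained in \<open>C - {e}\<close>, a vertex outside
    \<open>C\<close> that extends \<open>C - {e}\<close> would extend \<open>A\<close> and thus lie
    in \<open>C\<close>. Only \<open>e\<close> is left.\<close>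
  moreover have "extending G (C - {e}) \<subseteq> {e}"
    using e by (auto simp: extending_def C_def)
  then have "card (extending G (C - {e})) \<le> 1"
    using card_mono[of "{e}"] by simp
  ultimately show False
    by simp
qed

text \<open>Greedy growth by induction on the number of vertices still missing: below the
  independence number, \<open>extending_outside\<close> always supplies a further vertex that avoids
  \<open>B\<close>.\<close>

lemma extend_to_max_independent:
  assumes ext: "\<And>A. independent G A \<Longrightarrow> card A < independence_number G \<Longrightarrow> 2 \<le> card (extending G A)"
    and "independent G A" "independent G B" "A \<inter> B = {}"
  shows "\<exists>S. max_independent G S \<and> A \<subseteq> S \<and> S \<inter> B = {}"
  using assms(2-)
proof (induction "independence_number G - card A" arbitrary: A rule: less_induct)
  case less
  show ?case
  proof (cases "card A < independence_number G")
    case False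
    then show ?thesis
      using less.prems card_le_independence_number[of A] max_independent_iff[of A] by auto
  next
    case True
    then obtain v where v: "v \<in> extending G A" "v \<notin> B"
      using extending_outside[OF ext less.prems(1) True less.prems(2)] by blast
    have "card (insert v A) = Suc (card A)"
      using v independent_finite[OF less.prems(1)] by (auto simp: extending_def)
    then have "independence_number G - card (insert v A) < independence_number G - card A"
      using True by simp
    from less.hyps[OF this independent_insert_extending[OF less.prems(1) v(1)] less.prems(2)]
    show ?thesis
      using v less.prems by auto
  qed
qed

lemma W2_iff_card_extending:
  "W2 G \<longleftrightarrow>
     (\<forall>A. independent G A \<and> card A < independence_number G \<longrightarrow> 2 \<le> card (extending G A))"
  (is "_ \<longleftrightarrow> ?E")
proof
  assume "W2 G"
  then show ?E
    using W2_imp_card_extending by blast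
next
  assume ?E
  then have ext: "2 \<le> card (extending G A)"
    if "independent G A" "card A < independence_number G" for A
    using that by blast
  show "W2 G"
    unfolding W2_def
  proof (intro allI impI, elim conjE)
    fix A B assume AB: "independent G A" "independent G B" "A \<inter> B = {}"
    then obtain S where S: "max_independent G S" "A \<subseteq> S" "S \<inter> B = {}"
      using extend_to_max_independent[OF ext] by blast
    \<comment> \<open>The roles are exchanged: \<open>B\<close> now grows while avoiding the
      finished \<open>S\<close>. This is possible because the avoided set only has to be
      independent.\<close>
    then obtain T where "max_independent G T" "B \<subseteq> T" "T \<inter> S = {}"
      using extend_to_max_independent[OF ext AB(2), of S] max_independent_iff by blast
    with S show "\<exists>S T. max_independent G S \<and> max_independent G T \<and> S \<inter> T = {} \<and> A \<subseteq> S \<and> B \<subseteq> T"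
      by blast
  qed
qed

end

section \<open>From sets of vertices to lists of fixed length\<close>

lemma set_eq_list_of_length:
  assumes "finite A" "A \<noteq> {}" "card A \<le> m"
  obtains xs where "set xs = A" "length xs = m"
proof -
  obtain ys where ys: "set ys = A" "distinct ys"
    using assms finite_distinct_list by blast
  then have "length ys \<le> m" "ys \<noteq> []"
    using assms distinct_card by fastforce+
  \<comment> \<open>Padding repeats an element that is already present, which is why
    \<open>A\<close> must be nonempty.\<close>
  then have "set (ys @ replicate (m - length ys) (hd ys)) = A"
      "length (ys @ replicate (m - length ys) (hd ys)) = m"
    using ys by auto
  with that show ?thesis
    by blast
qed

definition good :: "'a pair_pre_digraph \<Rightarrow> 'a list \<Rightarrow> bool" where
  "good G xs \<longleftrightarrow> (independent G (set xs) \<longrightarrow> 2 \<le> card (extending G (set xs)))"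

text \<open>Lists may repeat vertices, so lists of the single length \<open>k - 1\<close> also cover the smaller sets.\<close>

lemma (in pair_graph) W2_iff_good:
  assumes "independence_number G = k" "k \<ge> 2"
  shows "W2 G \<longleftrightarrow> (\<forall>xs. length xs = k - 1 \<and> set xs \<subseteq> pverts G \<longrightarrow> good G xs)"
proof
  assume "W2 G"
  show "\<forall>xs. length xs = k - 1 \<and> set xs \<subseteq> pverts G \<longrightarrow> good G xs"
  proof (intro allI impI)
    fix xs assume "length xs = k - 1 \<and> set xs \<subseteq> pverts G"
    then have "card (set xs) < k"
      using card_length[of xs] assms by linarith
    then show "good G xs"
      using \<open>W2 G\<close> W2_imp_card_extending assms by (auto simp: good_def)
  qed
next
  assume good: "\<forall>xs. length xs = k - 1 \<and> set xs \<subseteq> pverts G \<longrightarrow> good G xs"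
  show "W2 G"
    unfolding W2_iff_card_extending
  proof (intro allI impI, elim conjE)
    fix A assume A: "independent G A" "card A < independence_number G"
    show "2 \<le> card (extending G A)"
    \<comment> \<open>As \<open>k - 1\<close> is positive, no list of that length has an empty set.
      Every vertex extends the empty set, and there are at least \<open>k\<close> vertices.\<close>
    proof (cases "A = {}")
      case True
      then have "extending G A = pverts G"
        by (simp add: extending_def)
      then show ?thesis
        using independence_number_le assms by simp
    next
      case False
      moreover have "card A \<le> k - 1"
        using A assms by simp
      ultimately obtain xs where "set xs = A" "length xs = k - 1"
        using set_eq_list_of_length independent_finite[OF A(1)] by metis
      then show ?thesis
        using good A by (auto simp: good_def independent_def)
    qed
  qed
qed


section \<open>A timed program logic for the machine\<close>

lemma run_0 [simp]: "run P 0 c = c"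
  by (simp add: run_def)

lemma run_Suc: "run P (Suc t) c = run P t (step P c)"
  by (simp add: run_def funpow_Suc_right del: funpow.simps)

lemma run_add: "run P (s + t) c = run P t (run P s c)"
  by (simp add: run_def add.commute[of s] funpow_add)

definition code_at :: "program \<Rightarrow> nat \<Rightarrow> instr list \<Rightarrow> bool" where
  "code_at P l cs \<longleftrightarrow> (\<exists>us vs. P = us @ cs @ vs \<and> length us = l)"

lemma code_at_append:
  "code_at P l (cs @ ds) \<longleftrightarrow> code_at P l cs \<and> code_at P (l + length cs) ds"
proof
  assume "code_at P l (cs @ ds)"
  then obtain us vs where "P = us @ (cs @ ds) @ vs" "length us = l"
    unfolding code_at_def by blast
  then have "P = us @ cs @ (ds @ vs)" "P = (us @ cs) @ ds @ vs"
      "length us = l" "length (us @ cs) = l + length cs"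
    by auto
  then show "code_at P l cs \<and> code_at P (l + length cs) ds"
    unfolding code_at_def by blast
next
  assume "code_at P l cs \<and> code_at P (l + length cs) ds"
  then obtain us vs us' vs' where
    1: "P = us @ cs @ vs" "length us = l" and
    2: "P = us' @ ds @ vs'" "length us' = l + length cs"
    unfolding code_at_def by blast
  have "us' = take (l + length cs) P"
    using 2 by simp
  also have "\<dots> = us @ cs"
    using 1 by simp
  finally show "code_at P l (cs @ ds)"
    using 1 2 unfolding code_at_def by auto
qed

lemma code_at_Cons:
  "code_at P l (c # cs) \<longleftrightarrow> l < length P \<and> P ! l = c \<and> code_at P (Suc l) cs"
proof -
  have "code_at P l [c] \<longleftrightarrow> l < length P \<and> P ! l = c"
    unfolding code_at_def by (metis (no_types, lifting) append_Cons append_Nil id_take_nth_drop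
        length_append length_take less_add_same_cancel1 length_Cons min.absorb4
        nth_append_length zero_less_Suc add_Suc_right)
  then show ?thesis
    using code_at_append[of P l "[c]" cs] by simp
qed

lemma step_code [simp]: "l < length P \<Longrightarrow> step P (l, R, M) = exec (P ! l) (l, R, M)"
  by (simp add: step_def halted_def)

type_synonym regs = "nat \<Rightarrow> nat"
type_synonym code = "nat \<Rightarrow> instr list" \<comment> \<open>depends on the position it is placed at\<close>

text \<open>\<open>T\<close> is only an upper bound on the number of steps. The word bound covers
  every configuration on the way, both ends included, as \<open>decides_within\<close>
  demands.\<close>

definition reaches :: "nat \<Rightarrow> program \<Rightarrow> nat \<Rightarrow> config \<Rightarrow> config \<Rightarrow> bool" where
  "reaches b P T c c' \<longleftrightarrow>
     (\<exists>t\<le>T. run P t c = c' \<and> (\<forall>s\<le>t. words_bounded b (run P s c)))"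

lemma reaches_refl: "words_bounded b c \<Longrightarrow> reaches b P T c c"
  unfolding reaches_def by (rule exI[of _ 0]) auto

lemma reaches_trans:
  assumes "reaches b P T c c'" "reaches b P U c' c''"
  shows "reaches b P (T + U) c c''"
proof -
  obtain t where t: "t \<le> T" "run P t c = c'" "\<forall>s\<le>t. words_bounded b (run P s c)"
    using assms(1) unfolding reaches_def by blast
  obtain u where u: "u \<le> U" "run P u c' = c''" "\<forall>s\<le>u. words_bounded b (run P s c')"
    using assms(2) unfolding reaches_def by blast
  have "words_bounded b (run P s c)" if "s \<le> t + u" for s
  proof (cases "s \<le> t")
    case False
    then have "run P s c = run P (s - t) c'"
      using run_add[of P t "s - t" c] t by simp
    then show ?thesis
      using u that False by simp
  qed (use t in blast)
  then show ?thesis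
    unfolding reaches_def using t u run_add[of P t u c] by (intro exI[of _ "t + u"]) auto
qed

lemma reaches_mono: "reaches b P T c c' \<Longrightarrow> T \<le> U \<Longrightarrow> reaches b P U c c'"
  unfolding reaches_def using le_trans by blast

lemma reaches_bounded: "reaches b P T c c' \<Longrightarrow> words_bounded b c'"
  unfolding reaches_def by blast

lemma reaches_step:
  "words_bounded b c \<Longrightarrow> step P c = c' \<Longrightarrow> words_bounded b c' \<Longrightarrow> reaches b P 1 c c'"
  unfolding reaches_def by (rule exI[of _ 1]) (auto simp: run_Suc le_Suc_eq)

text \<open>The memory \<open>M\<close> is a parameter, since the program never stores.\<close>

definition triple ::
  "nat \<Rightarrow> (nat \<Rightarrow> nat) \<Rightarrow> (regs \<Rightarrow> bool) \<Rightarrow> code \<Rightarrow> nat \<Rightarrow> (regs \<Rightarrow> bool) \<Rightarrow> bool"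
where
  "triple b M P C T Q \<longleftrightarrow>
     (\<forall>p l R. code_at p l (C l) \<and> P R \<and> words_bounded b (l, R, M) \<longrightarrow>
        (\<exists>R'. Q R' \<and> reaches b p T (l, R, M) (l + length (C l), R', M)))"

lemma tripleE:
  assumes "triple b M P C T Q" "code_at p l (C l)" "P R" "words_bounded b (l, R, M)"
  obtains R' where "Q R'" "reaches b p T (l, R, M) (l + length (C l), R', M)"
  using assms unfolding triple_def by blast

lemma triple_conseq:
  assumes "triple b M P C T Q" "\<And>R. P' R \<Longrightarrow> P R" "\<And>R. Q R \<Longrightarrow> Q' R" "T \<le> T'"
  shows "triple b M P' C T' Q'"
  using assms unfolding triple_def by (meson reaches_mono)

definition seq :: "code \<Rightarrow> code \<Rightarrow> code" where
  "seq C D l = C l @ D (l + length (C l))"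

lemma triple_seq:
  assumes "triple b M P C T Q" "triple b M Q D U S"
  shows "triple b M P (seq C D) (T + U) S"
  unfolding triple_def
proof (intro allI impI, elim conjE)
  fix p l R
  assume code: "code_at p l (seq C D l)" and R: "P R" "words_bounded b (l, R, M)"
  obtain R' where R': "Q R'" "reaches b p T (l, R, M) (l + length (C l), R', M)"
    using tripleE[OF assms(1) _ R] code unfolding seq_def code_at_append by blast
  obtain R'' where "S R''"
    "reaches b p U (l + length (C l), R', M)
       (l + length (C l) + length (D (l + length (C l))), R'', M)"
    using tripleE[OF assms(2) _ R'(1) reaches_bounded[OF R'(2)]] code
    unfolding seq_def code_at_append by blast
  then show "\<exists>R'. S R' \<and> reaches b p (T + U) (l, R, M) (l + length (seq C D l), R', M)"
    using reaches_trans[OF R'(2)] by (auto simp: seq_def add.assoc)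
qed

section \<open>Straight-line code\<close>

definition block :: "instr list \<Rightarrow> code" where
  "block cs l = cs"

lemma block_append: "block (cs @ ds) = seq (block cs) (block ds)"
  by (simp add: block_def seq_def fun_eq_iff)

text \<open>Weakest precondition including the word bound. \<open>Sub\<close> and
  \<open>Load\<close> carry no bound condition, since their results never exceed a word already
  present. Jumps and stores are excluded by \<open>False\<close>.\<close>

fun wp :: "nat \<Rightarrow> (nat \<Rightarrow> nat) \<Rightarrow> instr list \<Rightarrow> (regs \<Rightarrow> bool) \<Rightarrow> regs \<Rightarrow> bool" where
  "wp b M [] Q R = Q R"
| "wp b M (Const r c # cs) Q R = (c \<le> b \<and> wp b M cs Q (R(r := c)))"
| "wp b M (Add r s t # cs) Q R = (R s + R t \<le> b \<and> wp b M cs Q (R(r := R s + R t)))"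
| "wp b M (Sub r s t # cs) Q R = wp b M cs Q (R(r := R s - R t))"
| "wp b M (Load r s # cs) Q R = wp b M cs Q (R(r := M (R s)))"
| "wp b M (c # cs) Q R = False"

lemma wp_reaches:
  "wp b M cs Q R \<Longrightarrow> code_at p l cs \<Longrightarrow> words_bounded b (l, R, M) \<Longrightarrow>
    \<exists>R'. Q R' \<and> reaches b p (length cs) (l, R, M) (l + length cs, R', M)"
proof (induction b M cs Q R arbitrary: l rule: wp.induct)
  case (1 b M Q R)
  then show ?case
    by (auto intro: reaches_refl)
next
  case (2 b M r c cs Q R)
  then have "reaches b p 1 (l, R, M) (Suc l, R(r := c), M)"
    by (intro reaches_step) (auto simp: code_at_Cons words_bounded_def)
  with 2 show ?case
    using reaches_trans[of b p 1 _ _ "length cs"] reaches_bounded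
    by (fastforce simp: code_at_Cons)
next
  case (3 b M r s t cs Q R)
  then have "reaches b p 1 (l, R, M) (Suc l, R(r := R s + R t), M)"
    by (intro reaches_step) (auto simp: code_at_Cons words_bounded_def)
  with 3 show ?case
    using reaches_trans[of b p 1 _ _ "length cs"] reaches_bounded
    by (fastforce simp: code_at_Cons)
next
  case (4 b M r s t cs Q R)
  then have "R s - R t \<le> b"
    by (auto simp: words_bounded_def intro: order_trans[OF diff_le_self])
  with 4 have "reaches b p 1 (l, R, M) (Suc l, R(r := R s - R t), M)"
    by (intro reaches_step) (auto simp: code_at_Cons words_bounded_def)
  with 4 show ?case
    using reaches_trans[of b p 1 _ _ "length cs"] reaches_bounded
    by (fastforce simp: code_at_Cons)
next
  case (5 b M r s cs Q R)
  then have "reaches b p 1 (l, R, M) (Suc l, R(r := M (R s)), M)"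
    by (intro reaches_step) (auto simp: code_at_Cons words_bounded_def)
  with 5 show ?case
    using reaches_trans[of b p 1 _ _ "length cs"] reaches_bounded
    by (fastforce simp: code_at_Cons)
qed auto

lemma triple_block:
  assumes "\<And>R. P R \<Longrightarrow> wp b M cs Q R" "length cs \<le> T"
  shows "triple b M P (block cs) T Q"
  unfolding triple_def block_def
  using wp_reaches[OF assms(1)] reaches_mono[OF _ assms(2)] by blast

text \<open>Rule for unrolled loops: the invariant is indexed by the set of items already processed,
  so it can be a conjunction over that set. The induction runs over the remaining suffix.\<close>

lemma triple_concat:
  assumes "\<And>S z. S \<subseteq> set zs \<Longrightarrow> z \<in> set zs \<Longrightarrow> triple b M (I S) (block (f z)) T (I (insert z S))"
  shows "triple b M (I {}) (block (concat (map f zs))) (length zs * T) (I (set zs))"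
proof -
  have "triple b M (I (set xs)) (block (concat (map f ys))) (length ys * T) (I (set zs))"
    if "zs = xs @ ys" for xs ys
    using that
  proof (induction ys arbitrary: xs)
    case Nil
    then show ?case
      by (auto intro: triple_block)
  next
    case (Cons y ys)
    have "triple b M (I (set xs)) (block (f y)) T (I (set (xs @ [y])))"
      using assms[of "set xs" y] Cons.prems by auto
    moreover have "triple b M (I (set (xs @ [y]))) (block (concat (map f ys))) (length ys * T) (I (set zs))"
      by (rule Cons.IH) (simp add: Cons.prems)
    ultimately show ?case
      by (simp add: block_append triple_seq)
  qed
  from this[of "[]" zs] show ?thesis
    by simp
qed

text \<open>Register 2 holds the number of vertices. The body has to increment \<open>r\<close> itself.\<close>

definition loop :: "nat \<Rightarrow> code \<Rightarrow> code" where
  "loop r C l =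
     [Sub 3 2 r, JumpZero 3 (l + 3 + length (C (l + 2)))] @ C (l + 2) @ [Jump l]"

text \<open>A round costs two steps for the test, \<open>T\<close> for the body and one for the jump
  back; the last test adds 2. The test overwrites register 3, hence the requirement
  \<open>I_upd\<close>.\<close>

lemma triple_loop:
  assumes body: "\<And>j. j < n \<Longrightarrow> triple b M (I j) C T (I (Suc j))"
    and I_regs: "\<And>j R. I j R \<Longrightarrow> R r = j \<and> R 2 = n"
    and I_upd: "\<And>j R x. I j R \<Longrightarrow> I j (R(3 := x))"
  shows "triple b M (I 0) (loop r C) (n * (T + 3) + 2) (I n)"
  unfolding triple_def
proof (intro allI impI, elim conjE)
  fix p l R
  assume code: "code_at p l (loop r C l)" and R: "I 0 R" "words_bounded b (l, R, M)"
  have code': "l < length p" "p ! l = Sub 3 2 r" "Suc l < length p"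
    "p ! Suc l = JumpZero 3 (l + length (loop r C l))"
    "code_at p (l + 2) (C (l + 2))"
    "l + 2 + length (C (l + 2)) < length p" "p ! (l + 2 + length (C (l + 2))) = Jump l"
    using code by (auto simp: loop_def code_at_Cons code_at_append)
  have head: "reaches b p 2 (l, R, M)
      (if n - j = 0 then l + length (loop r C l) else l + 2, R(3 := n - j), M)"
    if "I j R" "words_bounded b (l, R, M)" for j R
  proof -
    have eq: "R r = j" "R 2 = n"
      using that I_regs by auto
    then have "n - j \<le> b"
      using that by (auto simp: words_bounded_def intro: order_trans[OF diff_le_self])
    then have "reaches b p 1 (l, R, M) (Suc l, R(3 := n - j), M)"
      using that code' eq by (intro reaches_step) (auto simp: words_bounded_def)
    moreover have "reaches b p 1 (Suc l, R(3 := n - j), M)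
        (if n - j = 0 then l + length (loop r C l) else l + 2, R(3 := n - j), M)"
      using that code' \<open>n - j \<le> b\<close> by (intro reaches_step) (auto simp: words_bounded_def)
    ultimately show ?thesis
      using reaches_trans by (metis one_add_one)
  qed
  have "\<exists>R'. I n R' \<and> reaches b p ((n - j) * (T + 3) + 2) (l, R, M) (l + length (loop r C l), R', M)"
    if "j \<le> n" "I j R" "words_bounded b (l, R, M)" for j R
    using that
  proof (induction "n - j" arbitrary: j R)
    case 0
    then have "n - j = 0" "n = j"
      by simp_all
    from head[OF 0(3,4), unfolded if_P[OF this(1)]]
    have "reaches b p ((n - j) * (T + 3) + 2) (l, R, M) (l + length (loop r C l), R(3 := n - j), M)"
      by (rule reaches_mono) simp
    moreover have "I n (R(3 := n - j))"
      unfolding \<open>n = j\<close> using 0(3) by (rule I_upd)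
    ultimately show ?case
      by blast
  next
    case (Suc d)
    then have j: "j < n"
      by simp
    have h: "reaches b p 2 (l, R, M) (l + 2, R(3 := n - j), M)"
      using head[OF Suc.prems(2,3)] j by simp
    obtain R' where R': "I (Suc j) R'"
      "reaches b p T (l + 2, R(3 := n - j), M) (l + 2 + length (C (l + 2)), R', M)"
      using tripleE[OF body[OF j] code'(5) I_upd[OF Suc.prems(2)] reaches_bounded[OF h]]
      by blast
    have bd: "words_bounded b (l, R', M)"
      using reaches_bounded[OF R'(2)] by (simp add: words_bounded_def)
    have "reaches b p 1 (l + 2 + length (C (l + 2)), R', M) (l, R', M)"
      using reaches_bounded[OF R'(2)] bd code' by (intro reaches_step) auto
    then have 1: "reaches b p (T + 3) (l, R, M) (l, R', M)"
      by (rule reaches_mono[OF reaches_trans[OF reaches_trans[OF h R'(2)]]]) simp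
    obtain R'' where "I n R''"
      "reaches b p ((n - Suc j) * (T + 3) + 2) (l, R', M) (l + length (loop r C l), R'', M)"
      using Suc.hyps(1)[OF _ _ R'(1) bd] Suc.hyps(2) j
      by (metis Suc_leI Suc_diff_Suc nat.inject)
    moreover have "T + 3 + ((n - Suc j) * (T + 3) + 2) = (n - j) * (T + 3) + 2"
      using j by (metis Suc_diff_Suc add.assoc mult_Suc)
    ultimately show ?case
      using reaches_trans[OF 1] by metis
  qed
  from this[of 0 R] R
  show "\<exists>R'. I n R' \<and> reaches b p (n * (T + 3) + 2) (l, R, M) (l + length (loop r C l), R', M)"
    by simp
qed


section \<open>The program\<close>

text \<open>
  Register 0 holds the answer so far, 1 the constant one, 2 the number \<open>n\<close> of vertices, 3 and 8 are
  scratch. The current vertices are the registers \<open>xr i\<close>; \<open>br i\<close> is the address of the first entry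
  of the corresponding row of the adjacency matrix. For the candidate vertex in register 5,
  register 4 records whether it extends the current set; 6 counts the extending vertices, and 7
  records whether the current set is independent. Truth values are 0 and 1, so that truncated
  subtraction replaces branching.
\<close>

definition xr :: "nat \<Rightarrow> nat" where "xr i = 9 + 2 * i"
definition br :: "nat \<Rightarrow> nat" where "br i = 10 + 2 * i"

text \<open>Subtracting the matrix entry from the flag in register 7 clears it exactly when the pair
  is adjacent; a cleared flag stays 0 by truncation.\<close>

definition pair_code :: "nat \<times> nat \<Rightarrow> instr list" where
  "pair_code q = [Add 3 (br (fst q)) (xr (snd q)), Load 3 3, Sub 7 7 3]"

text \<open>The first three instructions clear the flag on adjacency. The others clear it on
  equality: the two truncated differences add up to the distance, and 1 minus the distance is 1 only
  for equal vertices.\<close>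

definition candidate_code :: "nat \<Rightarrow> instr list" where
  "candidate_code i =
     [Add 3 (br i) 5, Load 3 3, Sub 4 4 3,
      Sub 3 (xr i) 5, Sub 8 5 (xr i), Add 3 3 8, Sub 3 1 3, Sub 4 4 3]"

definition count_code :: "nat \<Rightarrow> code" where
  "count_code m =
     seq (block [Const 4 1])
       (seq (block (concat (map candidate_code [0..<m])))
         (block [Add 6 6 4, Add 5 5 1]))"

text \<open>In the last block, register 6 becomes 1 iff at most one vertex extends the set. Adding
  the independence flag and subtracting 1 forms the conjunction of the two, and this clears the
  answer.\<close>

definition check_code :: "nat \<Rightarrow> code" where
  "check_code m =
     seq (block [Const 7 1])
       (seq (block (concat (map pair_code (List.product [0..<m] [0..<m]))))
         (seq (block [Const 5 0, Const 6 0])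
           (seq (loop 5 (count_code m))
             (block [Sub 6 6 1, Sub 6 1 6, Add 7 7 6, Sub 7 7 1, Sub 0 0 7]))))"

text \<open>\<open>i\<close> counts the enclosing loops, \<open>d\<close> those still to be opened.
  Moving the row address on by \<open>n\<close> in each round replaces a multiplication; it starts
  at 1, where the matrix begins.\<close>

primrec nest_code :: "nat \<Rightarrow> nat \<Rightarrow> code" where
  "nest_code i 0 = check_code i"
| "nest_code i (Suc d) =
     seq (block [Const (xr i) 0, Const (br i) 1])
       (loop (xr i)
         (seq (nest_code (Suc i) d) (block [Add (br i) (br i) 2, Add (xr i) (xr i) 1])))"

text \<open>Register 2 is initially 0, so \<open>Load 2 2\<close> fetches the number of vertices
  from cell 0.\<close>

definition W2_code :: "nat \<Rightarrow> code" where
  "W2_code m = seq (block [Const 0 1, Const 1 1, Load 2 2]) (nest_code 0 m)"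

text \<open>The bracketing is the one produced by nested uses of \<open>triple_seq\<close>, one
  summand for each part of \<open>check_code\<close>.\<close>

definition check_time :: "nat \<Rightarrow> nat \<Rightarrow> nat" where
  "check_time m n = 1 + (m * m * 3 + (2 + ((n * ((1 + (m * 8 + 2)) + 3) + 2) + 5)))"

primrec nest_time :: "nat \<Rightarrow> nat \<Rightarrow> nat \<Rightarrow> nat" where
  "nest_time i n 0 = check_time i n"
| "nest_time i n (Suc d) = 2 + (n * ((nest_time (Suc i) n d + 2) + 3) + 2)"

definition holds_tuple :: "nat \<Rightarrow> nat list \<Rightarrow> bool \<Rightarrow> regs \<Rightarrow> bool" where
  "holds_tuple n xs r R \<longleftrightarrow>
     R 0 = of_bool r \<and> R 1 = 1 \<and> R 2 = n \<and>
     (\<forall>i<length xs. R (xr i) = xs ! i \<and> R (br i) = xs ! i * n + 1)"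

lemma xr_br_neq [simp]:
  "xr i \<noteq> br j" "br j \<noteq> xr i" "xr i = xr j \<longleftrightarrow> i = j" "br i = br j \<longleftrightarrow> i = j"
  "xr i \<noteq> 0" "br i \<noteq> 0" "0 \<noteq> xr i" "0 \<noteq> br i"
  "xr i \<noteq> Suc 0" "br i \<noteq> Suc 0" "Suc 0 \<noteq> xr i" "Suc 0 \<noteq> br i"
  unfolding xr_def br_def by presburger+

lemma xr_br_neq_numeral [simp]:
  assumes "q < 9"
  shows "xr i \<noteq> q" "br i \<noteq> q" "q \<noteq> xr i" "q \<noteq> br i"
  using assms unfolding xr_def br_def by linarith+

lemma holds_tuple_upd_work [simp]:
  "3 \<le> q \<Longrightarrow> q < 9 \<Longrightarrow> holds_tuple n xs r (R(q := x)) \<longleftrightarrow> holds_tuple n xs r R"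
  by (auto simp: holds_tuple_def)

lemma holds_tuple_snoc:
  "holds_tuple n (xs @ [x]) r R \<longleftrightarrow>
     holds_tuple n xs r R \<and> R (xr (length xs)) = x \<and> R (br (length xs)) = x * n + 1"
  by (auto simp: holds_tuple_def nth_append less_Suc_eq)

lemma holds_tuple_upd_tuple [simp]:
  "length xs \<le> i \<Longrightarrow> holds_tuple n xs r (R(xr i := x)) \<longleftrightarrow> holds_tuple n xs r R"
  "length xs \<le> i \<Longrightarrow> holds_tuple n xs r (R(br i := x)) \<longleftrightarrow> holds_tuple n xs r R"
  by (auto simp: holds_tuple_def)

section \<open>Correctness of the program on a fixed input graph\<close>

locale graph_input = pair_graph G for G :: "nat pair_pre_digraph" +
  fixes n b :: nat
  assumes verts: "pverts G = {..<n}" and bound: "n * n + n + 2 \<le> b"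
begin

abbreviation "M \<equiv> graph_memory n G"

lemma row_bound: "u < n \<Longrightarrow> u * n + n \<le> n * n"
  using mult_le_mono1[of "Suc u" n n] by simp

lemma entry:
  assumes "u < n" "v < n"
  shows "M (u * n + 1 + v) = of_bool ((u, v) \<in> parcs G)"
proof -
  have "u * n + 1 + v \<le> n * n"
    using row_bound[OF assms(1)] assms(2) by simp
  then show ?thesis
    using assms by (simp add: graph_memory_def)
qed

lemma triple_pair_code:
  assumes xs: "set xs \<subseteq> {..<n}" and q: "fst q < length xs" "snd q < length xs"
  shows "triple b M
    (\<lambda>R. holds_tuple n xs r R \<and> R 7 = of_bool (\<forall>p\<in>S. (xs ! fst p, xs ! snd p) \<notin> parcs G))
    (block (pair_code q)) 3
    (\<lambda>R. holds_tuple n xs r R \<and> R 7 = of_bool (\<forall>p\<in>insert q S. (xs ! fst p, xs ! snd p) \<notin> parcs G))"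
proof (rule triple_block)
  have lt: "xs ! fst q < n" "xs ! snd q < n"
    using xs q by (meson lessThan_iff nth_mem subsetD)+
  fix R
  assume R: "holds_tuple n xs r R \<and> R 7 = of_bool (\<forall>p\<in>S. (xs ! fst p, xs ! snd p) \<notin> parcs G)"
  then have regs: "R (br (fst q)) = xs ! fst q * n + 1" "R (xr (snd q)) = xs ! snd q"
    using q by (auto simp: holds_tuple_def)
  show "wp b M (pair_code q) (\<lambda>R. holds_tuple n xs r R \<and>
      R 7 = of_bool (\<forall>p\<in>insert q S. (xs ! fst p, xs ! snd p) \<notin> parcs G)) R"
    using R regs bound row_bound[OF lt(1)] lt(2) entry[OF lt]
    by (auto simp: pair_code_def)
qed (simp add: pair_code_def)

lemma triple_candidate_code:
  assumes xs: "set xs \<subseteq> {..<n}" and i: "i < length xs" and v: "v < n"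
  shows "triple b M
    (\<lambda>R. holds_tuple n xs r R \<and> R 5 = v \<and> R 6 = c \<and> R 7 = f \<and>
       R 4 = of_bool (\<forall>i\<in>S. (xs ! i, v) \<notin> parcs G \<and> xs ! i \<noteq> v))
    (block (candidate_code i)) 8
    (\<lambda>R. holds_tuple n xs r R \<and> R 5 = v \<and> R 6 = c \<and> R 7 = f \<and>
       R 4 = of_bool (\<forall>i\<in>insert i S. (xs ! i, v) \<notin> parcs G \<and> xs ! i \<noteq> v))"
proof (rule triple_block)
  have lt: "xs ! i < n"
    using xs i by (meson lessThan_iff nth_mem subsetD)
  fix R
  assume R: "holds_tuple n xs r R \<and> R 5 = v \<and> R 6 = c \<and> R 7 = f \<and>
       R 4 = of_bool (\<forall>i\<in>S. (xs ! i, v) \<notin> parcs G \<and> xs ! i \<noteq> v)"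
  then have regs: "R (br i) = xs ! i * n + 1" "R (xr i) = xs ! i" "R (Suc 0) = Suc 0"
    using i by (auto simp: holds_tuple_def)
  have eq: "Suc 0 - (xs ! i - v + (v - xs ! i)) = of_bool (xs ! i = v)"
    by auto
  show "wp b M (candidate_code i) (\<lambda>R. holds_tuple n xs r R \<and> R 5 = v \<and> R 6 = c \<and> R 7 = f \<and>
       R 4 = of_bool (\<forall>i\<in>insert i S. (xs ! i, v) \<notin> parcs G \<and> xs ! i \<noteq> v)) R"
    using R regs bound row_bound[OF lt] v lt entry[OF lt v]
    by (auto simp: candidate_code_def eq)
qed (simp add: candidate_code_def)

lemma extending_set:
  assumes "set xs \<subseteq> {..<n}" "v < n"
  shows "v \<in> extending G (set xs) \<longleftrightarrow>
    (\<forall>i\<in>set [0..<length xs]. (xs ! i, v) \<notin> parcs G \<and> xs ! i \<noteq> v)"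
  using assms verts by (auto simp: extending_def all_set_conv_all_nth) (auto simp: in_set_conv_nth)

lemma independent_set:
  assumes "set xs \<subseteq> {..<n}"
  shows "independent G (set xs) \<longleftrightarrow>
    (\<forall>p\<in>set (List.product [0..<length xs] [0..<length xs]). (xs ! fst p, xs ! snd p) \<notin> parcs G)"
  using assms verts by (auto simp: independent_def all_set_conv_all_nth)

definition counted :: "nat list \<Rightarrow> bool \<Rightarrow> nat \<Rightarrow> regs \<Rightarrow> bool" where
  "counted xs r j R \<longleftrightarrow> holds_tuple n xs r R \<and> R 5 = j \<and>
     R 6 = card (extending G (set xs) \<inter> {..<j}) \<and> R 7 = of_bool (independent G (set xs))"

lemma card_extending_le: "card (extending G A \<inter> {..<j}) \<le> j"
  using card_mono[of "{..<j}" "extending G A \<inter> {..<j}"] by simp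

lemma triple_count_code:
  assumes xs: "set xs \<subseteq> {..<n}" and j: "j < n"
  shows "triple b M (counted xs r j) (count_code (length xs)) (1 + (length xs * 8 + 2))
    (counted xs r (Suc j))"
proof -
  define c where "c = card (extending G (set xs) \<inter> {..<j})"
  define f :: nat where "f = of_bool (independent G (set xs))"
  define I where "I S R \<longleftrightarrow> holds_tuple n xs r R \<and> R 5 = j \<and> R 6 = c \<and> R 7 = f \<and>
       R 4 = of_bool (\<forall>i\<in>S. (xs ! i, j) \<notin> parcs G \<and> xs ! i \<noteq> j)" for S R
  have "triple b M (I {}) (block (concat (map candidate_code [0..<length xs])))
      (length [0..<length xs] * 8) (I (set [0..<length xs]))"
    unfolding I_def by (intro triple_concat triple_candidate_code) (use xs j in auto)
  then have 1: "triple b M (I {}) (block (concat (map candidate_code [0..<length xs])))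
      (length xs * 8) (I (set [0..<length xs]))"
    by simp
  have 0: "triple b M (counted xs r j) (block [Const 4 1]) 1 (I {})"
    using bound by (intro triple_block) (auto simp: counted_def I_def c_def f_def)
  have 2: "triple b M (I (set [0..<length xs])) (block [Add 6 6 4, Add 5 5 1]) 2
      (counted xs r (Suc j))"
  proof (rule triple_block)
    fix R assume "I (set [0..<length xs]) R"
    then have R: "holds_tuple n xs r R" "R 5 = j" "R 6 = c" "R 7 = f"
      "R 4 = of_bool (j \<in> extending G (set xs))"
      unfolding I_def using extending_set[OF xs j] by auto
    have "R 1 = 1"
      using R by (simp add: holds_tuple_def)
    moreover have "c \<le> j"
      unfolding c_def by (rule card_extending_le)
    moreover have "card (extending G (set xs) \<inter> {..<Suc j}) = c + R 4"
      unfolding R c_def by (simp add: lessThan_Suc Int_insert_right)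
    ultimately show "wp b M [Add 6 6 4, Add 5 5 1] (counted xs r (Suc j)) R"
      using R j bound by (auto simp: counted_def f_def)
  qed simp
  show ?thesis
    unfolding count_code_def by (rule triple_seq[OF 0 triple_seq[OF 1 2]])
qed

lemma triple_check_code:
  assumes xs: "set xs \<subseteq> {..<n}"
  shows "triple b M (holds_tuple n xs r) (check_code (length xs)) (check_time (length xs) n)
    (holds_tuple n xs (r \<and> good G xs))"
proof -
  define I where "I S R \<longleftrightarrow> holds_tuple n xs r R \<and>
    R 7 = of_bool (\<forall>p\<in>S. (xs ! fst p, xs ! snd p) \<notin> parcs G)" for S R
  let ?ps = "List.product [0..<length xs] [0..<length xs]"
  have "triple b M (I {}) (block (concat (map pair_code ?ps))) (length ?ps * 3) (I (set ?ps))"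
    unfolding I_def by (intro triple_concat triple_pair_code) (use xs in auto)
  then have 1: "triple b M (I {}) (block (concat (map pair_code ?ps)))
      (length xs * length xs * 3) (I (set ?ps))"
    by simp
  have 0: "triple b M (holds_tuple n xs r) (block [Const 7 1]) 1 (I {})"
    using bound by (intro triple_block) (auto simp: I_def)
  have 2: "triple b M (I (set ?ps)) (block [Const 5 0, Const 6 0]) 2 (counted xs r 0)"
    by (intro triple_block) (auto simp: I_def counted_def independent_set[OF xs])
  have 3: "triple b M (counted xs r 0) (loop 5 (count_code (length xs)))
      (n * ((1 + (length xs * 8 + 2)) + 3) + 2) (counted xs r n)"
    by (intro triple_loop triple_count_code xs) (auto simp: counted_def holds_tuple_def)
  have 4: "triple b M (counted xs r n)
     (block [Sub 6 6 1, Sub 6 1 6, Add 7 7 6, Sub 7 7 1, Sub 0 0 7]) 5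
     (holds_tuple n xs (r \<and> good G xs))"
  proof (rule triple_block)
    fix R assume R: "counted xs r n R"
    \<comment> \<open>After the last candidate the count is no longer partial.\<close>
    have "extending G (set xs) \<inter> {..<n} = extending G (set xs)"
      using verts by (auto simp: extending_def)
    then have good: "good G xs \<longleftrightarrow> (R 7 = 1 \<longrightarrow> 2 \<le> R 6)" and 7: "R 7 \<le> 1"
      using R by (auto simp: counted_def good_def)
    have R': "R (Suc 0) = 1" "R 0 = of_bool r" "holds_tuple n xs r R"
      using R by (auto simp: counted_def holds_tuple_def)
    have ans: "R 0 - (R 7 + (Suc 0 - (R 6 - Suc 0)) - Suc 0) = of_bool (r \<and> good G xs)"
      using 7 R' by (auto simp: good)
    have "R 7 + (Suc 0 - (R 6 - Suc 0)) \<le> b"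
      using 7 bound by linarith
    then show "wp b M [Sub 6 6 1, Sub 6 1 6, Add 7 7 6, Sub 7 7 1, Sub 0 0 7]
        (holds_tuple n xs (r \<and> good G xs)) R"
      using ans R' by (simp add: holds_tuple_def)
  qed simp
  show ?thesis
    unfolding check_code_def check_time_def
    by (rule triple_seq[OF 0 triple_seq[OF 1 triple_seq[OF 2 triple_seq[OF 3 4]]]])
qed

definition all_good :: "nat \<Rightarrow> nat list \<Rightarrow> bool" where
  "all_good d xs \<longleftrightarrow> (\<forall>ys. length ys = d \<and> set ys \<subseteq> {..<n} \<longrightarrow> good G (xs @ ys))"

lemma all_good_0: "all_good 0 xs \<longleftrightarrow> good G xs"
  by (simp add: all_good_def)

lemma all_good_Suc: "all_good (Suc d) xs \<longleftrightarrow> (\<forall>y<n. all_good d (xs @ [y]))"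
  unfolding all_good_def by (fastforce simp: length_Suc_conv)

text \<open>Induction on the number of loops still to be opened. Both \<open>xs\<close> and
  \<open>r\<close> vary: an inner loop runs for every value of the outer ones and continues with the
  answer found so far.\<close>

lemma triple_nest_code:
  "set xs \<subseteq> {..<n} \<Longrightarrow>
    triple b M (holds_tuple n xs r) (nest_code (length xs) d) (nest_time (length xs) n d)
      (holds_tuple n xs (r \<and> all_good d xs))"
proof (induction d arbitrary: xs r)
  case 0
  then show ?case
    using triple_check_code by (simp add: all_good_0)
next
  case (Suc d)
  define i where "i = length xs"
  \<comment> \<open>On exit the last entry is \<open>n\<close>, which is not a vertex; the final
    weakening to the prefix \<open>xs\<close> discards it.\<close>
  define I where "I j = holds_tuple n (xs @ [j]) (r \<and> (\<forall>y<j. all_good d (xs @ [y])))" for j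
  have 0: "triple b M (holds_tuple n xs r) (block [Const (xr i) 0, Const (br i) 1]) 2 (I 0)"
    using bound by (intro triple_block) (auto simp: I_def holds_tuple_snoc i_def)
  have body: "triple b M (I j)
      (seq (nest_code (Suc i) d) (block [Add (br i) (br i) 2, Add (xr i) (xr i) 1]))
      (nest_time (Suc i) n d + 2) (I (Suc j))"
    if j: "j < n" for j
  proof (rule triple_seq)
    show "triple b M (I j) (nest_code (Suc i) d) (nest_time (Suc i) n d)
        (holds_tuple n (xs @ [j]) (r \<and> (\<forall>y<Suc j. all_good d (xs @ [y]))))"
    proof -
      have "(r \<and> (\<forall>y<Suc j. all_good d (xs @ [y]))) =
          ((r \<and> (\<forall>y<j. all_good d (xs @ [y]))) \<and> all_good d (xs @ [j]))"
        by (auto simp: less_Suc_eq)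
      then show ?thesis
        using Suc.IH[of "xs @ [j]" "r \<and> (\<forall>y<j. all_good d (xs @ [y]))"] Suc.prems j
        by (simp only: I_def i_def) simp
    qed
    show "triple b M (holds_tuple n (xs @ [j]) (r \<and> (\<forall>y<Suc j. all_good d (xs @ [y]))))
      (block [Add (br i) (br i) 2, Add (xr i) (xr i) 1]) 2 (I (Suc j))"
    proof (rule triple_block)
      fix R assume R: "holds_tuple n (xs @ [j]) (r \<and> (\<forall>y<Suc j. all_good d (xs @ [y]))) R"
      then have "R (Suc 0) = 1" "R 2 = n"
        by (auto simp: holds_tuple_def)
      then show "wp b M [Add (br i) (br i) 2, Add (xr i) (xr i) 1] (I (Suc j)) R"
        using R row_bound[OF j] bound j by (simp add: I_def holds_tuple_snoc i_def)
    qed simp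
  qed
  have 1: "triple b M (I 0)
      (loop (xr i) (seq (nest_code (Suc i) d) (block [Add (br i) (br i) 2, Add (xr i) (xr i) 1])))
      (n * ((nest_time (Suc i) n d + 2) + 3) + 2) (I n)"
  proof (rule triple_loop)
    show "R (xr i) = j \<and> R 2 = n" if "I j R" for j R
      using that by (auto simp: I_def holds_tuple_snoc i_def) (auto simp: holds_tuple_def)
    show "I j (R(3 := x))" if "I j R" for j R x
      using that holds_tuple_upd_work[of 3] by (simp only: I_def)
  qed (rule body)
  have "triple b M (holds_tuple n xs r) (nest_code i (Suc d)) (nest_time i n (Suc d)) (I n)"
    unfolding nest_code.simps nest_time.simps by (rule triple_seq[OF 0 1])
  then show ?case
    unfolding i_def by (rule triple_conseq) (auto simp: I_def holds_tuple_snoc all_good_Suc)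
qed

lemma reaches_W2_code:
  shows "\<exists>R. R 0 = of_bool (all_good m []) \<and>
    reaches b (W2_code m 0) (3 + nest_time 0 n m) (initial_config n G)
      (length (W2_code m 0), R, M)"
proof -
  have "triple b M (\<lambda>R. \<forall>i. R i = 0) (block [Const 0 1, Const 1 1, Load 2 2]) 3
      (holds_tuple n [] True)"
    using bound by (intro triple_block) (auto simp: holds_tuple_def graph_memory_def)
  from triple_seq[OF this triple_nest_code[of "[]" True m]]
  have "triple b M (\<lambda>R. \<forall>i. R i = 0) (W2_code m) (3 + nest_time 0 n m)
      (holds_tuple n [] (all_good m []))"
    by (simp add: W2_code_def)
  moreover have "code_at (W2_code m 0) 0 (W2_code m 0)"
    by (auto simp: code_at_def)
  moreover have "words_bounded b (0, \<lambda>_. 0, M)"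
    using bound by (auto simp: words_bounded_def graph_memory_def)
  ultimately show ?thesis
    by (elim tripleE) (auto simp: initial_config_def holds_tuple_def)
qed

end

section \<open>Bounding the running time\<close>

lemma nest_time_le: "\<exists>C. \<forall>n\<ge>1. nest_time i n d \<le> C * n ^ Suc d"
proof (induction d arbitrary: i)
  case 0
  \<comment> \<open>Expanded, \<open>check_time i n\<close> is
    \<open>(10 + 3 * i * i) + (6 + 8 * i) * n\<close>.\<close>
  have "nest_time i n 0 \<le> (10 + 3 * i * i + 6 + 8 * i) * n ^ Suc 0" if "n \<ge> 1" for n
  proof -
    have "(10 + 3 * i * i) * 1 \<le> (10 + 3 * i * i) * n"
      using that by (intro mult_le_mono) auto
    then show ?thesis
      by (simp add: check_time_def algebra_simps)
  qed
  then show ?case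
    by blast
next
  case (Suc d)
  then obtain C where C: "\<And>n. n \<ge> 1 \<Longrightarrow> nest_time (Suc i) n d \<le> C * n ^ Suc d"
    by blast
  \<comment> \<open>A loop multiplies the time of its body by \<open>n\<close> and adds an overhead
    of \<open>4 + 5 * n\<close>, whence the 9.\<close>
  have "nest_time i n (Suc d) \<le> (C + 9) * n ^ Suc (Suc d)" if "n \<ge> 1" for n
  proof -
    have pow: "n \<le> n ^ Suc (Suc d)" "1 \<le> n ^ Suc (Suc d)"
      using that by (auto simp: Suc_le_eq)
    have "n * nest_time (Suc i) n d \<le> n * (C * n ^ Suc d)"
      using C[OF that] by simp
    also have "\<dots> = C * n ^ Suc (Suc d)"
      by simp
    finally have "4 + 5 * n + n * nest_time (Suc i) n d \<le> (C + 9) * n ^ Suc (Suc d)"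
      unfolding distrib_right using pow by linarith
    then show ?thesis
      by (simp add: algebra_simps)
  qed
  then show ?case
    by blast
qed

lemma nest_time_bigo: "(\<lambda>n. real (3 + nest_time 0 n d)) \<in> O(\<lambda>n. real n ^ Suc d)"
proof -
  obtain C where C: "\<And>n. n \<ge> 1 \<Longrightarrow> nest_time 0 n d \<le> C * n ^ Suc d"
    using nest_time_le by blast
  have "3 + nest_time 0 n d \<le> (C + 3) * n ^ Suc d" if "n \<ge> 1" for n
  proof -
    have "1 \<le> n ^ Suc d"
      using that by (intro one_le_power)
    then show ?thesis
      unfolding distrib_right using C[OF that] by linarith
  qed
  then have "real (3 + nest_time 0 n d) \<le> real (C + 3) * real n ^ Suc d" if "n \<ge> 1" for n
    using that by (metis of_nat_le_iff of_nat_mult of_nat_power)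
  then show ?thesis
    by (intro bigoI[of _ "real (C + 3)"] eventually_sequentiallyI[of 1]) auto
qed

theorem theorem8p3:
  fixes k :: nat
  assumes "k \<ge> 2"
  shows "\<exists>P T. T \<in> O(\<lambda>n. real n ^ k) \<and>
           decides_within P T (\<lambda>G. independence_number G = k) W2"
proof (intro exI conjI)
  let ?P = "W2_code (k - 1) 0" and ?T = "\<lambda>n. real (3 + nest_time 0 n (k - 1))"
  show "?T \<in> O(\<lambda>n. real n ^ k)"
    using nest_time_bigo[of "k - 1"] assms by simp
  show "decides_within ?P ?T (\<lambda>G. independence_number G = k) W2"
    unfolding decides_within_def
  proof (rule exI[of _ 4], intro allI impI, elim conjE)
    fix n :: nat and G :: "nat pair_pre_digraph"
    assume G: "pair_graph G" "pverts G = {..<n}" "independence_number G = k"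
    \<comment> \<open>The left side suffices for all words: row addresses reach
      \<open>n * n + 1\<close> after a last round, and the sum of two flags reaches 2. On the right,
      4 is both exponent and additive constant, as in \<open>n ^ c + c\<close>.\<close>
    have "n * n + n + 2 \<le> n ^ 4 + 4"
    proof (cases "n \<le> 1")
      case True
      then show ?thesis
        by (cases n) auto
    next
      case False
      then have "n * 2 \<le> n * n" "n * n * 2 \<le> n * n * (n * n)"
        using mult_le_mono[of 2 n 2 n] by (auto intro!: mult_le_mono)
      then show ?thesis
        by (simp add: eval_nat_numeral mult.assoc)
    qed
    then interpret graph_input G n "n ^ 4 + 4"
      using G by (simp add: graph_input_def graph_input_axioms_def)
    \<comment> \<open>The promise on the independence number enters here; the program never computes
      that number.\<close>
    have W2: "W2 G \<longleftrightarrow> all_good (k - 1) []"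
      using W2_iff_good[OF G(3) assms] verts by (simp add: all_good_def)
    obtain R t where "R 0 = of_bool (all_good (k - 1) [])" "t \<le> 3 + nest_time 0 n (k - 1)"
      "run ?P t (initial_config n G) = (length ?P, R, M)"
      "\<forall>s\<le>t. words_bounded (n ^ 4 + 4) (run ?P s (initial_config n G))"
      using reaches_W2_code[of "k - 1"] unfolding reaches_def by blast
    then show "\<exists>t pc R M'. real t \<le> ?T n \<and>
        run ?P t (initial_config n G) = (pc, R, M') \<and> halted ?P (pc, R, M') \<and>
        R 0 = (if W2 G then 1 else 0) \<and>
        (\<forall>s\<le>t. words_bounded (n ^ 4 + 4) (run ?P s (initial_config n G)))"
      by (intro exI[of _ t] exI[of _ "length ?P"] exI[of _ R] exI[of _ M])
        (simp add: W2 halted_def)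
  qed
qed

end
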